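(* Let $\boldsymbol S$ be the sufficient statistic distributed according to a regular conditionally reducible natural exponential family (cr-NEF) on $\mathbb R^d$, parameterized by $\boldsymbol\phi\in\boldsymbol\Phi=\Phi_1\times\cdots\times\Phi_d$, with $\Phi_k$ coinciding with the natural parameter space of the $k$-th conditional distribution. Then, for $\boldsymbol S=\boldsymbol s$, with $s_k\in\mathcal S_k^*$ for $k=1,\dots,d$, $$H_{\boldsymbol s}(\boldsymbol\phi)=\prod_{k=1}^d H_{\boldsymbol s_{[k]}}(\phi_k)=\prod_{k=1}^d\left(1-F_{\phi_k}(s_k\mid\boldsymbol s_{[k-1]})\right)$$ is a fiducial distribution function on $\boldsymbol\phi$, with density $$h_{\boldsymbol s}(\boldsymbol\phi)=\prod_{k=1}^d h_{\boldsymbol s_{[k]}}(\phi_k),\qquad\text{where}\quad h_{\boldsymbol s_{[k]}}(\phi_k)=\frac{\partial}{\partial\phi_k}H_{\boldsymbol s_{[k]}}(\phi_k)=-\frac{\partial}{\partial\phi_k}F_{\phi_k}(s_k\mid\boldsymbol s_{[k-1]}).$$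
   Context: Notation: $\boldsymbol v_{[k]}=(v_1,\dots,v_k)$. A natural exponential family on $\mathbb R^d$ with density $\exp\{\sum_{k=1}^d\theta_kx_k-M(\boldsymbol\theta)\}$, with respect to a $\sigma$-finite measure, $\boldsymbol\theta\in\boldsymbol\Theta$, is ($d$-)conditionally reducible (cr-NEF) if its joint density factorizes as a product of $d$ conditional densities each belonging to a real exponential family, $$p_{\boldsymbol\phi}(\boldsymbol x)=\prod_{k=1}^d\exp\{\phi_kx_k-M_k(\phi_k;\boldsymbol x_{[k-1]})\},$$ where $\boldsymbol\phi=(\phi_1,\dots,\phi_d)$ is a one-to-one function from $\boldsymbol\Theta$ onto $\boldsymbol\Phi=\Phi_1\times\cdots\times\Phi_d$; the $k$-th factor is the conditional density of $X_k$ given $\boldsymbol X_{[k-1]}=\boldsymbol x_{[k-1]}$, a real natural exponential family with natural parameter $\phi_k\in\Phi_k$. "Regular" means that the natural parameter spaces are open. $F_{\phi_k}(s_k\mid\boldsymbol s_{[k-1]})$ is the conditional distribution function of $S_k$ given $\boldsymbol S_{[k-1]}=\boldsymbol s_{[k-1]}$. Let $\nu_k$ be the dominating measure of this conditional family and $a_k,b_k$ the infimum and supremum of its support; $\mathcal S_k^*=[a_k,b_k)$ if $\nu_k(\{a_k\})>0$ and $\mathcal S_k^*=(a_k,b_k)$ otherwise. $H_{\boldsymbol s_{[k]}}(\phi_k)=1-F_{\phi_k}(s_k\mid\boldsymbol s_{[k-1]})$ for $\phi_k\in\Phi_k$, extended as $0$ for $\phi_k\le\inf\Phi_k$ and as $1$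 for $\phi_k\ge\sup\Phi_k$. A fiducial distribution function on $\boldsymbol\phi$ here means a joint probability distribution function for $\boldsymbol\phi$ obtained by the step-by-step fiducial construction: for each $k$, the real parameter $\phi_k$ indexing the conditional distribution of $S_k$ given $\boldsymbol S_{[k-1]}=\boldsymbol s_{[k-1]}$ is given the distribution with density $\left|\frac{\partial}{\partial\phi_k}F_{\phi_k}(s_k\mid\boldsymbol s_{[k-1]})\right|$, and the joint fiducial density is the product of these one-dimensional densities. *)

theory Defs
  imports "HOL-Probability.Probability"
begin

section \<open>Conventions\<close>

text \<open>
  A point of $d$-dimensional Euclidean space is an extensional function on \<open>{..<d}\<close>, so coordinates
  are numbered from \<open>0\<close>: coordinate \<open>k\<close> here is coordinate \<open>k + 1\<close> in the usual numbering, and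
  the vector of the coordinates preceding it is \<open>restrict x {..<k}\<close>.
\<close>

abbreviation euclR :: "nat \<Rightarrow> (nat \<Rightarrow> real) measure" where
  "euclR d \<equiv> PiM {..<d} (\<lambda>_. borel)"

abbreviation lebR :: "nat \<Rightarrow> (nat \<Rightarrow> real) measure" where
  "lebR d \<equiv> PiM {..<d} (\<lambda>_. lborel)"


section \<open>Natural exponential families\<close>

definition nat_space :: "nat \<Rightarrow> (nat \<Rightarrow> real) measure \<Rightarrow> (nat \<Rightarrow> real) set" where
  "nat_space d \<nu> =
     {\<theta> \<in> {..<d} \<rightarrow>\<^sub>E UNIV. (\<integral>\<^sup>+ x. ennreal (exp (\<Sum>k<d. \<theta> k * x k)) \<partial>\<nu>) < \<infinity>}"

definition real_nat_space :: "real measure \<Rightarrow> real set" where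
  "real_nat_space \<mu> = {t. (\<integral>\<^sup>+ y. ennreal (exp (t * y)) \<partial>\<mu>) < \<infinity>}"

definition nef_law ::
  "nat \<Rightarrow> (nat \<Rightarrow> real) measure \<Rightarrow> ((nat \<Rightarrow> real) \<Rightarrow> real) \<Rightarrow> (nat \<Rightarrow> real) \<Rightarrow> (nat \<Rightarrow> real) measure" where
  "nef_law d \<nu> M \<theta> = density \<nu> (\<lambda>x. ennreal (exp ((\<Sum>k<d. \<theta> k * x k) - M \<theta>)))"

text \<open>
  \<open>\<nu>c k x\<close> is the dominating measure and \<open>Mc k t x\<close> the log-normalizer of the conditional family of
  coordinate \<open>k\<close> given that the preceding coordinates equal \<open>x\<close>.
\<close>

definition cond_law ::
  "(nat \<Rightarrow> (nat \<Rightarrow> real) \<Rightarrow> real measure) \<Rightarrow> (nat \<Rightarrow> real \<Rightarrow> (nat \<Rightarrow> real) \<Rightarrow> real)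
     \<Rightarrow> nat \<Rightarrow> real \<Rightarrow> (nat \<Rightarrow> real) \<Rightarrow> real measure" where
  "cond_law \<nu>c Mc k t x = density (\<nu>c k x) (\<lambda>y. ennreal (exp (t * y - Mc k t x)))"

definition cr_density ::
  "nat \<Rightarrow> (nat \<Rightarrow> real \<Rightarrow> (nat \<Rightarrow> real) \<Rightarrow> real) \<Rightarrow> (nat \<Rightarrow> real) \<Rightarrow> (nat \<Rightarrow> real) \<Rightarrow> real" where
  "cr_density d Mc \<phi> x = (\<Prod>k<d. exp (\<phi> k * x k - Mc k (\<phi> k) (restrict x {..<k})))"

text \<open>
  \<open>K\<close> is a regular conditional distribution, under \<open>P\<close>, of coordinate \<open>k\<close> given the preceding
  coordinates. It is only specified for conditioning values in a measurable set \<open>D\<close> of full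
  probability: a multinomial vector, for instance, has no meaningful conditional law given partial
  counts exceeding the number of trials.
\<close>

definition is_cond_law ::
  "nat \<Rightarrow> (nat \<Rightarrow> real) measure \<Rightarrow> (nat \<Rightarrow> real) set \<Rightarrow> ((nat \<Rightarrow> real) \<Rightarrow> real measure) \<Rightarrow> bool" where
  "is_cond_law k P D K \<longleftrightarrow>
     D \<in> sets (euclR k) \<and>
     (AE x in P. restrict x {..<k} \<in> D) \<and>
     K \<in> measurable (restrict_space (euclR k) D) (prob_algebra borel) \<and>
     (\<forall>A\<in>sets (euclR k). \<forall>B\<in>sets borel. A \<subseteq> D \<longrightarrow>
        emeasure P {x \<in> space P. restrict x {..<k} \<in> A \<and> x k \<in> B} =
        (\<integral>\<^sup>+ x. indicator A (restrict x {..<k}) * emeasure (K (restrict x {..<k})) B \<partial>P))"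

text \<open>
  \<open>g\<close> is the reparametrization sending the natural parameter to \<open>\<phi>\<close>.
\<close>

locale cr_nef =
  fixes d :: nat
    and \<nu> :: "(nat \<Rightarrow> real) measure"
    and \<Theta> :: "(nat \<Rightarrow> real) set"
    and M :: "(nat \<Rightarrow> real) \<Rightarrow> real"
    and g :: "(nat \<Rightarrow> real) \<Rightarrow> nat \<Rightarrow> real"
    and \<Phi> :: "nat \<Rightarrow> real set"
    and D :: "nat \<Rightarrow> (nat \<Rightarrow> real) set"
    and \<nu>c :: "nat \<Rightarrow> (nat \<Rightarrow> real) \<Rightarrow> real measure"
    and Mc :: "nat \<Rightarrow> real \<Rightarrow> (nat \<Rightarrow> real) \<Rightarrow> real"
  assumes dim_pos: "d \<ge> 1"
    and sets_base: "sets \<nu> = sets (euclR d)"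
    and sigma_finite_base: "sigma_finite_measure \<nu>"
    and \<Theta>_nonempty: "\<Theta> \<noteq> {}"
    and \<Theta>_subset: "\<Theta> \<subseteq> {..<d} \<rightarrow>\<^sub>E UNIV"
    and nef_prob: "\<And>\<theta>. \<theta> \<in> \<Theta> \<Longrightarrow> prob_space (nef_law d \<nu> M \<theta>)"
    and reparam: "bij_betw g \<Theta> (PiE {..<d} \<Phi>)"
    and sets_cond: "\<And>k x. k < d \<Longrightarrow> x \<in> D k \<Longrightarrow> sets (\<nu>c k x) = sets borel"
    and sigma_finite_cond: "\<And>k x. k < d \<Longrightarrow> x \<in> D k \<Longrightarrow> sigma_finite_measure (\<nu>c k x)"
    and factorization: "\<And>\<theta>. \<theta> \<in> \<Theta> \<Longrightarrow>
      (AE x in \<nu>. exp ((\<Sum>k<d. \<theta> k * x k) - M \<theta>) = cr_density d Mc (g \<theta>) x)"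
    and conditional: "\<And>\<theta> k. \<theta> \<in> \<Theta> \<Longrightarrow> k < d \<Longrightarrow>
      is_cond_law k (nef_law d \<nu> M \<theta>) (D k) (cond_law \<nu>c Mc k (g \<theta> k))"

locale regular_cr_nef = cr_nef +
  assumes \<Theta>_natural: "\<Theta> = nat_space d \<nu>"
    and \<Theta>_open: "openin (product_topology (\<lambda>_. euclidean) {..<d}) \<Theta>"
    and cond_open: "\<And>k x. k < d \<Longrightarrow> x \<in> D k \<Longrightarrow> open (real_nat_space (\<nu>c k x))"


section \<open>Admissible observations\<close>

definition supp :: "real measure \<Rightarrow> real set" where
  "supp \<mu> = {x. \<forall>U. open U \<longrightarrow> x \<in> U \<longrightarrow> emeasure \<mu> U > 0}"

definition supp_inf :: "real measure \<Rightarrow> ereal" where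
  "supp_inf \<mu> = (INF x\<in>supp \<mu>. ereal x)"

definition supp_sup :: "real measure \<Rightarrow> ereal" where
  "supp_sup \<mu> = (SUP x\<in>supp \<mu>. ereal x)"

text \<open>
  The set in the condition below is the singleton of the lower endpoint when that endpoint is
  finite, and empty otherwise.
\<close>

definition S_star :: "real measure \<Rightarrow> real set" where
  "S_star \<mu> =
     (if emeasure \<mu> {y. ereal y = supp_inf \<mu>} > 0
      then {y. supp_inf \<mu> \<le> ereal y \<and> ereal y < supp_sup \<mu>}
      else {y. supp_inf \<mu> < ereal y \<and> ereal y < supp_sup \<mu>})"


section \<open>Fiducial distributions\<close>

definition cond_df ::
  "(nat \<Rightarrow> (nat \<Rightarrow> real) \<Rightarrow> real measure) \<Rightarrow> (nat \<Rightarrow> real \<Rightarrow> (nat \<Rightarrow> real) \<Rightarrow> real)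
     \<Rightarrow> (nat \<Rightarrow> real) \<Rightarrow> nat \<Rightarrow> real \<Rightarrow> real" where
  "cond_df \<nu>c Mc s k t = cdf (cond_law \<nu>c Mc k t (restrict s {..<k})) (s k)"

text \<open>
  In the following definitions \<open>F k t\<close> stands for the \<open>k\<close>-th conditional distribution function at
  the observed point, as a function of its parameter \<open>t\<close>. A natural parameter space is convex,
  so for such an open \<open>\<Phi> k\<close> the last branch of \<open>H1\<close> is the case of \<open>t\<close> not below the supremum.
\<close>

definition H1 :: "(nat \<Rightarrow> real set) \<Rightarrow> (nat \<Rightarrow> real \<Rightarrow> real) \<Rightarrow> nat \<Rightarrow> real \<Rightarrow> real" where
  "H1 \<Phi> F k t =
     (if t \<in> \<Phi> k then 1 - F k t
      else if ereal t \<le> (INF u\<in>\<Phi> k. ereal u) then 0 else 1)"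

definition Hjoint :: "nat \<Rightarrow> (nat \<Rightarrow> real set) \<Rightarrow> (nat \<Rightarrow> real \<Rightarrow> real) \<Rightarrow> (nat \<Rightarrow> real) \<Rightarrow> real" where
  "Hjoint d \<Phi> F \<phi> = (\<Prod>k<d. H1 \<Phi> F k (\<phi> k))"

text \<open>
  Densities on the parameter space are extended by \<open>0\<close> outside it.
\<close>

definition h1 :: "(nat \<Rightarrow> real set) \<Rightarrow> (nat \<Rightarrow> real \<Rightarrow> real) \<Rightarrow> nat \<Rightarrow> real \<Rightarrow> real" where
  "h1 \<Phi> F k t = (if t \<in> \<Phi> k then deriv (H1 \<Phi> F k) t else 0)"

definition hjoint :: "nat \<Rightarrow> (nat \<Rightarrow> real set) \<Rightarrow> (nat \<Rightarrow> real \<Rightarrow> real) \<Rightarrow> (nat \<Rightarrow> real) \<Rightarrow> real" where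
  "hjoint d \<Phi> F \<phi> = (\<Prod>k<d. h1 \<Phi> F k (\<phi> k))"

definition is_df_with_density ::
  "nat \<Rightarrow> ((nat \<Rightarrow> real) \<Rightarrow> real) \<Rightarrow> ((nat \<Rightarrow> real) \<Rightarrow> real) \<Rightarrow> bool" where
  "is_df_with_density d G h \<longleftrightarrow>
     h \<in> borel_measurable (lebR d) \<and>
     (\<forall>\<psi>\<in>space (lebR d). 0 \<le> h \<psi>) \<and>
     prob_space (density (lebR d) (\<lambda>\<psi>. ennreal (h \<psi>))) \<and>
     (\<forall>\<phi>\<in>{..<d} \<rightarrow>\<^sub>E UNIV. G \<phi> =
        measure (density (lebR d) (\<lambda>\<psi>. ennreal (h \<psi>))) {\<psi> \<in> space (lebR d). \<forall>k<d. \<psi> k \<le> \<phi> k})"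

definition fid_density1 :: "(nat \<Rightarrow> real set) \<Rightarrow> (nat \<Rightarrow> real \<Rightarrow> real) \<Rightarrow> nat \<Rightarrow> real \<Rightarrow> real" where
  "fid_density1 \<Phi> F k t = (if t \<in> \<Phi> k then \<bar>deriv (F k) t\<bar> else 0)"

definition is_fiducial_df ::
  "nat \<Rightarrow> (nat \<Rightarrow> real set) \<Rightarrow> (nat \<Rightarrow> real \<Rightarrow> real) \<Rightarrow> ((nat \<Rightarrow> real) \<Rightarrow> real) \<Rightarrow> bool" where
  "is_fiducial_df d \<Phi> F G \<longleftrightarrow>
     (\<forall>k<d. (\<forall>t\<in>\<Phi> k. F k field_differentiable at t) \<and>
            fid_density1 \<Phi> F k \<in> borel_measurable borel \<and>
            prob_space (density lborel (\<lambda>t. ennreal (fid_density1 \<Phi> F k t)))) \<and>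
     is_df_with_density d G (\<lambda>\<psi>. \<Prod>k<d. fid_density1 \<Phi> F k (\<psi> k))"

end

theory Submission
  imports Defs
begin

text \<open>
  The joint statement is a product of one-dimensional ones, because the parameter of each conditional
  law varies freely and the conditioning values are the fixed observed ones. So the substance lies
  in a single real exponential family with generating measure \<open>\<mu>\<close>, open natural parameter space \<open>T\<close>
  and observation \<open>s\<close>.

  Write \<open>L t\<close> and \<open>U t\<close> for the integrals of \<open>exp (t * (y - s))\<close> over \<open>y \<le> s\<close> and over \<open>y > s\<close>. Then
  the upper tail probability \<open>1 - F t\<close> equals \<open>H t = U t / (L t + U t)\<close>. The factor
  \<open>y - s\<close> of the exponent is nonpositive on the first part and positive on the second, so \<open>L\<close> decreases,
  \<open>U\<close> increases, and \<open>H\<close> is increasing. Laplace transforms are smooth inside their domain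
  (\<open>laplace_transform_has_derivative\<close>), hence \<open>H\<close> is continuously differentiable with a nonnegative
  derivative.

  It remains that no mass is lost at the ends of \<open>T\<close>: \<open>H\<close> tends to \<open>0\<close> on the left and to \<open>1\<close> on the
  right (\<open>H_tendsto_lower\<close>, \<open>H_tendsto_upper\<close>). At a finite end openness enters: the end is not in \<open>T\<close>,
  so \<open>L + U\<close> is infinite there, and by Fatou's lemma the one of \<open>L\<close>, \<open>U\<close> that is not controlled by
  monotonicity is unbounded near it. At an infinite end the condition that \<open>s\<close> lies in \<open>S_star \<mu>\<close>
  enters: both parts carry mass, \<open>U\<close> grows at least linearly at plus infinity and vanishes at minus
  infinity. The fundamental theorem of calculus then identifies \<open>H\<close> as the distribution function with
  density \<open>H'\<close>, and \<open>H' = - F'\<close> is the fiducial density (\<open>real_nef_fiducial\<close>).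
\<close>

section \<open>Laplace transforms and integration of derivatives\<close>

text \<open>
  The domination needed to differentiate a Laplace transform: \<open>z * exp (u * z)\<close> is the derivative of
  \<open>exp (u * z)\<close> in \<open>u\<close>, and the bound is uniform for \<open>u\<close> near \<open>t\<close>. One multiple of \<open>\<delta>\<close> in the
  exponent pays for moving from \<open>t\<close> to \<open>u\<close>, a second one for the factor \<open>z\<close>.
\<close>

lemma abs_mult_exp_le:
  fixes z t u \<delta> :: real
  assumes "\<delta> > 0" and "\<bar>u - t\<bar> \<le> \<delta>"
  shows "\<bar>z\<bar> * exp (u * z) \<le> (exp ((t + 2 * \<delta>) * z) + exp ((t - 2 * \<delta>) * z)) / \<delta>"
proof -
  have "(u - t) * z \<le> \<bar>u - t\<bar> * \<bar>z\<bar>"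
    by (metis abs_ge_self abs_mult)
  also have "\<dots> \<le> \<delta> * \<bar>z\<bar>"
    using assms by (intro mult_right_mono) auto
  finally have u: "u * z \<le> t * z + \<delta> * \<bar>z\<bar>"
    by (simp add: algebra_simps)
  have "\<delta> * \<bar>z\<bar> * exp (u * z) \<le> exp (\<delta> * \<bar>z\<bar>) * exp (t * z + \<delta> * \<bar>z\<bar>)"
    using u exp_ge_add_one_self[of "\<delta> * \<bar>z\<bar>"] assms(1)
    by (intro mult_mono) (auto simp del: exp_ge_add_one_self)
  also have "\<dots> = exp (t * z + 2 * \<delta> * \<bar>z\<bar>)"
    by (simp add: exp_add[symmetric])
  also have "\<dots> \<le> exp ((t + 2 * \<delta>) * z) + exp ((t - 2 * \<delta>) * z)"
    by (cases "z \<ge> 0") (auto simp: algebra_simps add_increasing add_increasing2)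
  finally show ?thesis
    using assms(1) by (simp add: field_simps)
qed

text \<open>
  Differentiation under the integral sign, by dominated convergence of the difference quotients.
  The weight \<open>f\<close> makes the statement iterable: its first part is the hypothesis for the weight
  \<open>X * f\<close>, so a second application gives continuity of the derivative.
\<close>

lemma laplace_transform_has_derivative:
  fixes X f :: "'a \<Rightarrow> real"
  assumes [measurable]: "X \<in> borel_measurable N" "f \<in> borel_measurable N"
    and "open T" "t \<in> T"
    and int: "\<And>u. u \<in> T \<Longrightarrow> integrable N (\<lambda>x. f x * exp (u * X x))"
  shows "integrable N (\<lambda>x. (X x * f x) * exp (t * X x))"
    and "((\<lambda>u. \<integral>x. f x * exp (u * X x) \<partial>N) has_real_derivative
           (\<integral>x. (X x * f x) * exp (t * X x) \<partial>N)) (at t)"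
proof -
  obtain r where r: "r > 0" "cball t r \<subseteq> T"
    using \<open>open T\<close> \<open>t \<in> T\<close> open_contains_cball by blast
  \<comment> \<open>Half the radius, because the dominating function evaluates the transform at distance \<open>2 * \<delta>\<close>.\<close>
  define \<delta> where "\<delta> = r / 2"
  have in_T: "u \<in> T" if "\<bar>u - t\<bar> \<le> 2 * \<delta>" for u
    using r that by (auto simp: \<delta>_def dist_real_def subset_iff abs_minus_commute)
  have \<delta>: "\<delta> > 0" using r by (simp add: \<delta>_def)
  define w where
    "w x = \<bar>f x\<bar> * ((exp ((t + 2 * \<delta>) * X x) + exp ((t - 2 * \<delta>) * X x)) / \<delta>)" for x
  have w_eq: "w x = (\<bar>f x * exp ((t + 2 * \<delta>) * X x)\<bar> + \<bar>f x * exp ((t - 2 * \<delta>) * X x)\<bar>) / \<delta>" for x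
    by (simp add: w_def abs_mult algebra_simps)
  have int_w: "integrable N w"
    unfolding w_eq using \<delta>
    by (intro integrable_divide_zero Bochner_Integration.integrable_add integrable_abs int in_T impI) auto
  have dom: "\<bar>X x * f x * exp (u * X x)\<bar> \<le> w x" if "\<bar>u - t\<bar> \<le> \<delta>" for u x
    using mult_left_mono[OF abs_mult_exp_le[OF \<delta> that, of "X x"], of "\<bar>f x\<bar>"]
    by (simp add: w_def abs_mult mult_ac)
  show int': "integrable N (\<lambda>x. (X x * f x) * exp (t * X x))"
    using dom[of t] \<delta> by (intro Bochner_Integration.integrable_bound[OF int_w]) (auto intro!: AE_I2 order_trans[OF dom])
  let ?L = "\<lambda>u. \<integral>x. f x * exp (u * X x) \<partial>N"
  have "((\<lambda>h. (?L (t + h) - ?L t) / h) \<longlongrightarrow> (\<integral>x. (X x * f x) * exp (t * X x) \<partial>N)) (at 0 within ball 0 \<delta>)"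
    unfolding tendsto_at_iff_sequentially
  proof (intro allI impI)
    fix h :: "nat \<Rightarrow> real"
    assume h: "\<forall>i. h i \<in> ball 0 \<delta> - {0}" and h0: "h \<longlonglongrightarrow> 0"
    have h: "h i \<noteq> 0" "\<bar>h i\<bar> < \<delta>" for i
      using h by (auto simp: dist_real_def)
    define q where "q i x = f x * ((exp ((t + h i) * X x) - exp (t * X x)) / h i)" for i x
    have q_int: "integral\<^sup>L N (q i) = (?L (t + h i) - ?L t) / h i" for i
    proof -
      have "integral\<^sup>L N (q i) = (\<integral>x. (f x * exp ((t + h i) * X x) - f x * exp (t * X x)) / h i \<partial>N)"
        by (simp add: q_def[abs_def] algebra_simps)
      also have "\<dots> = (?L (t + h i) - ?L t) / h i"
        using h[of i] by (subst integral_divide_zero, subst Bochner_Integration.integral_diff)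
          (auto intro!: int in_T)
      finally show ?thesis .
    qed
    have "(\<lambda>i. integral\<^sup>L N (q i)) \<longlonglongrightarrow> (\<integral>x. (X x * f x) * exp (t * X x) \<partial>N)"
    proof (rule integral_dominated_convergence[where w = w])
      show "AE x in N. (\<lambda>i. q i x) \<longlonglongrightarrow> (X x * f x) * exp (t * X x)"
      proof (rule AE_I2)
        fix x
        have "((\<lambda>u. exp (u * X x)) has_real_derivative X x * exp (t * X x)) (at t)"
          by (auto intro!: derivative_eq_intros)
        then have "(\<lambda>i. (exp ((t + h i) * X x) - exp (t * X x)) / h i) \<longlonglongrightarrow> X x * exp (t * X x)"
          using h h0 unfolding DERIV_def tendsto_at_iff_sequentially by (auto simp: comp_def)
        from tendsto_mult_left[OF this, of "f x"]
        show "(\<lambda>i. q i x) \<longlonglongrightarrow> (X x * f x) * exp (t * X x)"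
          by (simp add: q_def mult_ac)
      qed
      show "AE x in N. norm (q i x) \<le> w x" for i
      proof (rule AE_I2)
        fix x
        let ?e = "\<lambda>u. exp (u * X x)" and ?b = "(exp ((t + 2 * \<delta>) * X x) + exp ((t - 2 * \<delta>) * X x)) / \<delta>"
        have "norm (?e (t + h i) - ?e t) \<le> ?b * norm (t + h i - t)"
        proof (rule field_differentiable_bound[where S = "cball t \<delta>" and f' = "\<lambda>u. X x * ?e u"])
          show "(?e has_field_derivative X x * ?e u) (at u within cball t \<delta>)" for u
            by (auto intro!: derivative_eq_intros)
          show "norm (X x * ?e u) \<le> ?b" if "u \<in> cball t \<delta>" for u
            using abs_mult_exp_le[OF \<delta>, of u t "X x"] that by (simp add: abs_mult dist_real_def abs_minus_commute)
        qed (use \<delta> h[of i] in \<open>auto simp: dist_real_def\<close>)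
        then have "\<bar>(?e (t + h i) - ?e t) / h i\<bar> \<le> ?b"
          using h(1)[of i] by (simp add: divide_le_eq)
        from mult_left_mono[OF this, of "\<bar>f x\<bar>"] show "norm (q i x) \<le> w x"
          by (simp add: q_def w_def abs_mult)
      qed
    qed (use int_w in \<open>auto simp: q_def[abs_def]\<close>)
    then show "((\<lambda>h. (?L (t + h) - ?L t) / h) \<circ> h) \<longlonglongrightarrow> (\<integral>x. (X x * f x) * exp (t * X x) \<partial>N)"
      by (simp add: q_int comp_def)
  qed
  moreover have "at (0::real) within ball 0 \<delta> = at 0"
    using \<delta> by (intro at_within_open) auto
  ultimately show "(?L has_real_derivative (\<integral>x. (X x * f x) * exp (t * X x) \<partial>N)) (at t)"
    unfolding DERIV_def by simp
qed

text \<open>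
  By Fatou's lemma a Laplace transform cannot stay bounded on approach to a parameter at which it
  is infinite.
\<close>

lemma integrable_exp_mult_limit:
  fixes X f :: "'a \<Rightarrow> real"
  assumes [measurable]: "X \<in> borel_measurable N" "f \<in> borel_measurable N"
    and nonneg: "\<And>x. 0 \<le> f x" and lim: "u \<longlonglongrightarrow> t"
    and int: "\<And>n::nat. integrable N (\<lambda>x. f x * exp (u n * X x))"
    and bound: "\<And>n. (\<integral>x. f x * exp (u n * X x) \<partial>N) \<le> C"
  shows "integrable N (\<lambda>x. f x * exp (t * X x))"
proof (rule integrableI_nonneg)
  have "(\<integral>\<^sup>+x. ennreal (f x * exp (t * X x)) \<partial>N)
      = (\<integral>\<^sup>+x. liminf (\<lambda>n. ennreal (f x * exp (u n * X x))) \<partial>N)"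
    by (intro nn_integral_cong lim_imp_Liminf[symmetric] tendsto_ennrealI tendsto_intros lim) auto
  also have "\<dots> \<le> liminf (\<lambda>n. \<integral>\<^sup>+x. ennreal (f x * exp (u n * X x)) \<partial>N)"
    by (intro nn_integral_liminf) auto
  also have "\<dots> \<le> liminf (\<lambda>n. ennreal C)"
    by (intro Liminf_mono always_eventually allI, subst nn_integral_eq_integral[OF int])
      (auto simp: nonneg intro!: ennreal_leI bound)
  also have "\<dots> < \<infinity>" by (simp add: Liminf_const)
  finally show "(\<integral>\<^sup>+x. ennreal (f x * exp (t * X x)) \<partial>N) < \<infinity>" .
qed (auto simp: nonneg)

text \<open>
  The fundamental theorem of calculus for a nonnegative derivative on a possibly unbounded
  interval, phrased with the integral that computes measures given by densities.
\<close>

lemma nn_integral_einterval_derivative: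
  fixes f F :: "real \<Rightarrow> real" and a b :: ereal
  assumes "a < b"
    and F: "\<And>x. x \<in> einterval a b \<Longrightarrow> (F has_real_derivative f x) (at x)"
    and cont: "\<And>x. x \<in> einterval a b \<Longrightarrow> isCont f x"
    and nonneg: "\<And>x. x \<in> einterval a b \<Longrightarrow> 0 \<le> f x"
    and A: "((F \<circ> real_of_ereal) \<longlongrightarrow> A) (at_right a)"
    and B: "((F \<circ> real_of_ereal) \<longlongrightarrow> B) (at_left b)"
  shows "(\<integral>\<^sup>+x. ennreal (f x) * indicator (einterval a b) x \<partial>lborel) = ennreal (B - A)"
proof -
  note FTC = interval_integral_FTC_nonneg[OF \<open>a < b\<close> _ _ _ A B, of f]
  have "set_integrable lborel (einterval a b) f" and "(LBINT x=a..b. f x) = B - A"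
    using F cont nonneg by (auto intro!: FTC AE_I2 simp: einterval_iff)
  then have int: "integrable lborel (\<lambda>x. indicator (einterval a b) x * f x)"
    and eq: "(\<integral>x. indicator (einterval a b) x * f x \<partial>lborel) = B - A"
    using less_imp_le[OF \<open>a < b\<close>]
    by (simp_all add: interval_lebesgue_integral_def set_integrable_def set_lebesgue_integral_def)
  have "(\<integral>\<^sup>+x. ennreal (f x) * indicator (einterval a b) x \<partial>lborel)
      = (\<integral>\<^sup>+x. ennreal (indicator (einterval a b) x * f x) \<partial>lborel)"
    by (intro nn_integral_cong) (auto split: split_indicator)
  also have "\<dots> = ennreal (B - A)"
    using nonneg by (subst nn_integral_eq_integral[OF int])
      (auto simp: eq split: split_indicator)
  finally show ?thesis .
qed

section \<open>Tail probabilities of an exponential family in its parameter\<close>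

text \<open>
  With \<open>X y = y - s\<close>, the locale describes the exponential family generated by \<open>N\<close>, observed at \<open>s\<close>;
  centring at \<open>s\<close> only multiplies both tail integrals by \<open>exp (- t * s)\<close>. The two last hypotheses
  say that the observation splits \<open>N\<close> into two parts that both carry mass. \<open>H t\<close> is the probability,
  under the parameter \<open>t\<close>, of exceeding the observation.
\<close>

locale exponential_split =
  fixes N :: "'a measure" and X :: "'a \<Rightarrow> real" and T :: "real set"
  assumes X_measurable [measurable]: "X \<in> borel_measurable N"
    and T_natural: "T = {t. integrable N (\<lambda>x. exp (t * X x))}"
    and T_open: "open T"
    and T_nonempty: "T \<noteq> {}"
    and lower_part_nonnull: "\<not> (AE x in N. 0 < X x)"
    and upper_part_nonnull: "\<not> (AE x in N. X x \<le> 0)"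
begin

definition L :: "real \<Rightarrow> real" where
  "L t = (\<integral>x. indicator {x. X x \<le> 0} x * exp (t * X x) \<partial>N)"

definition U :: "real \<Rightarrow> real" where
  "U t = (\<integral>x. indicator {x. 0 < X x} x * exp (t * X x) \<partial>N)"

definition H :: "real \<Rightarrow> real" where
  "H t = U t / (L t + U t)"

definition L' :: "real \<Rightarrow> real" where
  "L' t = (\<integral>x. (X x * indicator {x. X x \<le> 0} x) * exp (t * X x) \<partial>N)"

definition U' :: "real \<Rightarrow> real" where
  "U' t = (\<integral>x. (X x * indicator {x. 0 < X x} x) * exp (t * X x) \<partial>N)"

abbreviation H' :: "real \<Rightarrow> real" where
  "H' t \<equiv> (U' t * L t - U t * L' t) / (L t + U t)\<^sup>2"

lemma integrable_indicator_exp: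
  fixes P :: "real \<Rightarrow> bool"
  assumes "t \<in> T" and [measurable]: "Measurable.pred borel P"
  shows "integrable N (\<lambda>x. indicator {x. P (X x)} x * exp (t * X x))"
proof (rule Bochner_Integration.integrable_bound)
  show "integrable N (\<lambda>x. exp (t * X x))"
    using assms(1) T_natural by simp
qed (auto split: split_indicator)

lemmas L_integrable = integrable_indicator_exp[where P = "\<lambda>y. y \<le> 0", simplified]
lemmas U_integrable = integrable_indicator_exp[where P = "\<lambda>y. 0 < y", simplified]

text \<open>
  \<open>exp (t * z)\<close> is at most \<open>exp (t1 * z)\<close> for \<open>z \<ge> 0\<close> and at most \<open>exp (t0 * z)\<close> for \<open>z < 0\<close>.
\<close>

lemma T_between:
  assumes "t0 \<in> T" "t1 \<in> T" "t0 \<le> t" "t \<le> t1"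
  shows "t \<in> T"
proof -
  have "exp (t * z) \<le> exp (t0 * z) + exp (t1 * z)" for z :: real
  proof (cases "z \<ge> 0")
    case True
    then have "t * z \<le> t1 * z" using assms by (intro mult_right_mono)
    then show ?thesis by (simp add: add_increasing)
  next
    case False
    then have "t * z \<le> t0 * z" using assms by (intro mult_right_mono_neg) auto
    then show ?thesis by (simp add: add_increasing2)
  qed
  moreover have "integrable N (\<lambda>x. exp (t0 * X x) + exp (t1 * X x))"
    using assms(1,2) T_natural by auto
  ultimately have "integrable N (\<lambda>x. exp (t * X x))"
    by (auto intro: Bochner_Integration.integrable_bound)
  then show ?thesis
    using T_natural by simp
qed

lemma T_eq_einterval: "T = einterval (INF t\<in>T. ereal t) (SUP t\<in>T. ereal t)"
proof (intro set_eqI iffI)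
  fix t assume "t \<in> T"
  then obtain e where e: "e > 0" "cball t e \<subseteq> T"
    using T_open open_contains_cball by blast
  have "t - e \<in> T" "t + e \<in> T"
    using e by (auto simp: subset_iff dist_real_def)
  then have "(INF t\<in>T. ereal t) \<le> ereal (t - e)" "ereal (t + e) \<le> (SUP t\<in>T. ereal t)"
    by (auto intro: INF_lower SUP_upper)
  moreover have "ereal (t - e) < ereal t" "ereal t < ereal (t + e)"
    using e by auto
  ultimately show "t \<in> einterval (INF t\<in>T. ereal t) (SUP t\<in>T. ereal t)"
    unfolding einterval_iff by (meson le_less_trans less_le_trans)
next
  fix t assume "t \<in> einterval (INF t\<in>T. ereal t) (SUP t\<in>T. ereal t)"
  then obtain t0 t1 where "t0 \<in> T" "t0 < t" "t1 \<in> T" "t < t1"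
    by (auto simp: einterval_iff INF_less_iff less_SUP_iff)
  then show "t \<in> T"
    by (auto intro: T_between[of t0 t1])
qed

lemma U_pos: "0 < U t" if "t \<in> T"
proof -
  have "U t \<noteq> 0"
  proof
    assume "U t = 0"
    then have "AE x in N. indicator {x. 0 < X x} x * exp (t * X x) = 0"
      unfolding U_def
      by (subst (asm) integral_nonneg_eq_0_iff_AE[OF U_integrable[OF that]]) auto
    then have "AE x in N. X x \<le> 0"
      by eventually_elim (auto split: split_indicator_asm)
    then show False using upper_part_nonnull by simp
  qed
  moreover have "0 \<le> U t" unfolding U_def by (intro integral_nonneg_AE) auto
  ultimately show ?thesis by simp
qed

lemma L_pos: "0 < L t" if "t \<in> T"
proof -
  have "L t \<noteq> 0"
  proof
    assume "L t = 0"
    then have "AE x in N. indicator {x. X x \<le> 0} x * exp (t * X x) = 0"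
      unfolding L_def
      by (subst (asm) integral_nonneg_eq_0_iff_AE[OF L_integrable[OF that]]) auto
    then have "AE x in N. 0 < X x"
      by eventually_elim (auto split: split_indicator_asm)
    then show False using lower_part_nonnull by simp
  qed
  moreover have "0 \<le> L t" unfolding L_def by (intro integral_nonneg_AE) auto
  ultimately show ?thesis by simp
qed

lemma U_mono: "U t \<le> U u" if "t \<in> T" "u \<in> T" "t \<le> u"
  unfolding U_def using that
  by (intro integral_mono U_integrable) (auto split: split_indicator intro: mult_right_mono)

lemma L_antimono: "L u \<le> L t" if "t \<in> T" "u \<in> T" "t \<le> u"
  unfolding L_def using that
  by (intro integral_mono L_integrable) (auto split: split_indicator intro: mult_right_mono_neg)

lemma U_has_derivative:
  assumes "t \<in> T"
  shows "integrable N (\<lambda>x. (X x * indicator {x. 0 < X x} x) * exp (t * X x))"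
    and "(U has_real_derivative U' t) (at t)"
  using laplace_transform_has_derivative[OF X_measurable _ T_open assms U_integrable]
  by (auto simp: U_def[abs_def] U'_def)

lemma L_has_derivative:
  assumes "t \<in> T"
  shows "integrable N (\<lambda>x. (X x * indicator {x. X x \<le> 0} x) * exp (t * X x))"
    and "(L has_real_derivative L' t) (at t)"
  using laplace_transform_has_derivative[OF X_measurable _ T_open assms L_integrable]
  by (auto simp: L_def[abs_def] L'_def)

lemma isCont_U': "isCont U' t" and isCont_L': "isCont L' t" if "t \<in> T"
proof -
  show "isCont U' t"
    using laplace_transform_has_derivative(2)[OF X_measurable _ T_open that U_has_derivative(1)]
    by (auto simp: U'_def[abs_def] intro: DERIV_isCont)
  show "isCont L' t"
    using laplace_transform_has_derivative(2)[OF X_measurable _ T_open that L_has_derivative(1)]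
    by (auto simp: L'_def[abs_def] intro: DERIV_isCont)
qed

lemma U'_nonneg: "0 \<le> U' t"
  unfolding U'_def by (intro integral_nonneg_AE) (auto split: split_indicator)

lemma L'_nonpos: "L' t \<le> 0"
proof -
  have "0 \<le> (\<integral>x. - ((X x * indicator {x. X x \<le> 0} x) * exp (t * X x)) \<partial>N)"
    by (intro integral_nonneg_AE) (auto split: split_indicator simp: mult_nonpos_nonneg)
  then show ?thesis by (simp add: L'_def)
qed

lemma U'_pos: "0 < U' t" if "t \<in> T"
proof -
  have "U' t \<noteq> 0"
  proof
    assume "U' t = 0"
    then have "AE x in N. (X x * indicator {x. 0 < X x} x) * exp (t * X x) = 0"
      unfolding U'_def
      by (subst (asm) integral_nonneg_eq_0_iff_AE[OF U_has_derivative(1)[OF that]])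
        (auto split: split_indicator)
    then have "AE x in N. X x \<le> 0"
      by eventually_elim (auto split: split_indicator_asm)
    then show False using upper_part_nonnull by simp
  qed
  with U'_nonneg[of t] show ?thesis by simp
qed

lemma H_has_derivative: "(H has_real_derivative H' t) (at t)" if "t \<in> T"
proof -
  have "L t + U t \<noteq> 0"
    using L_pos[OF that] U_pos[OF that] by simp
  then show ?thesis
    unfolding H_def[abs_def]
    by (auto intro!: derivative_eq_intros U_has_derivative(2) L_has_derivative(2) that
        simp: power2_eq_square field_simps)
qed

text \<open>
  This is where splitting at the observation matters: \<open>X\<close> has a constant sign on each part, so \<open>U\<close>
  increases, \<open>L\<close> decreases, and the numerator is a sum of two nonnegative terms.
\<close>

lemma H'_nonneg: "0 \<le> H' t" if "t \<in> T"
proof -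
  have "0 \<le> U' t * L t" and "U t * L' t \<le> 0"
    using U'_nonneg[of t] L'_nonpos[of t] L_pos[OF that] U_pos[OF that]
    by (simp_all add: mult_nonneg_nonpos)
  then show ?thesis by simp
qed

lemma isCont_H': "isCont H' t" if "t \<in> T"
proof -
  have "L t + U t \<noteq> 0"
    using L_pos[OF that] U_pos[OF that] by simp
  then show ?thesis
    using DERIV_isCont[OF U_has_derivative(2)[OF that]] DERIV_isCont[OF L_has_derivative(2)[OF that]]
      isCont_U'[OF that] isCont_L'[OF that]
    by (intro continuous_intros) auto
qed

lemma H_bounds: "0 < H t" "H t < 1" if "t \<in> T"
  using U_pos[OF that] L_pos[OF that] by (auto simp: H_def)

lemma H_mono: "H t \<le> H u" if "t \<in> T" "u \<in> T" "t \<le> u"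
proof (rule DERIV_nonneg_imp_nondecreasing[OF \<open>t \<le> u\<close>])
  fix x assume "t \<le> x" "x \<le> u"
  then have "x \<in> T" using that by (auto intro: T_between)
  then show "\<exists>y. (H has_real_derivative y) (at x) \<and> 0 \<le> y"
    using H_has_derivative H'_nonneg by blast
qed

text \<open>
  The parameter set contains every finite limit point along which both tail integrals stay bounded.
  As \<open>T\<close> is open, a finite endpoint is outside \<open>T\<close>, so one of them must be unbounded there.
\<close>

lemma in_T_if_bounded_at_limit:
  assumes "u \<longlonglongrightarrow> t" "\<And>n::nat. u n \<in> T" "\<And>n. L (u n) \<le> C" "\<And>n. U (u n) \<le> C"
  shows "t \<in> T"
proof -
  have "integrable N (\<lambda>x. indicator {x. X x \<le> 0} x * exp (t * X x))"
    using assms by (intro integrable_exp_mult_limit[OF _ _ _ assms(1), where C = C] L_integrable)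
      (auto simp: L_def)
  moreover have "integrable N (\<lambda>x. indicator {x. 0 < X x} x * exp (t * X x))"
    using assms by (intro integrable_exp_mult_limit[OF _ _ _ assms(1), where C = C] U_integrable)
      (auto simp: U_def)
  ultimately have "integrable N (\<lambda>x. indicator {x. X x \<le> 0} x * exp (t * X x)
      + indicator {x. 0 < X x} x * exp (t * X x))"
    by (rule Bochner_Integration.integrable_add)
  also have "(\<lambda>x. indicator {x. X x \<le> 0} x * exp (t * X x)
      + indicator {x. 0 < X x} x * exp (t * X x)) = (\<lambda>x. exp (t * X x))"
    by (auto split: split_indicator)
  finally show ?thesis
    using T_natural by simp
qed

text \<open>
  Towards the right end \<open>L\<close> is bounded. At a finite end \<open>U\<close> must therefore be unbounded; at an
  infinite end \<open>exp (v * z) \<ge> v * z\<close> gives \<open>U t \<ge> (t - t0) * U' t0\<close>.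
\<close>

lemma U_unbounded_above:
  assumes t0: "t0 \<in> T"
  shows "\<exists>t\<in>T. t0 \<le> t \<and> C < U t"
proof (rule ccontr)
  assume "\<not> ?thesis"
  then have bound: "U t \<le> C" if "t \<in> T" "t0 \<le> t" for t
    using that by force
  show False
  proof (cases "bdd_above T")
    case True
    have "Sup T \<in> closure T"
      using True T_nonempty by (intro closure_contains_Sup)
    then obtain u where u: "\<And>n::nat. u n \<in> T" "u \<longlonglongrightarrow> Sup T"
      unfolding closure_sequential by blast
    \<comment> \<open>Truncation keeps the sequence in the range where \<open>L\<close> is at most \<open>L t0\<close>.\<close>
    define v where "v n = max (u n) t0" for n
    have v: "v n \<in> T" "t0 \<le> v n" for n
      using u(1) t0 by (auto simp: v_def max_def)
    have "v \<longlonglongrightarrow> max (Sup T) t0"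
      unfolding v_def[abs_def] by (intro tendsto_max u tendsto_const)
    then have lim: "v \<longlonglongrightarrow> Sup T"
      using cSup_upper[OF t0 True] by (simp add: max_absorb1)
    have "Sup T \<in> T"
      by (rule in_T_if_bounded_at_limit[OF lim v(1), of "max C (L t0)"])
        (use bound[OF v] L_antimono[OF t0 v] in \<open>auto simp: le_max_iff_disj\<close>)
    then obtain e where e: "e > 0" "cball (Sup T) e \<subseteq> T"
      using T_open open_contains_cball by blast
    then have "Sup T + e \<in> T"
      by (auto simp: subset_iff dist_real_def)
    from cSup_upper[OF this True] e show False by simp
  next
    case False
    \<comment> \<open>Chosen so that the linear lower bound equals \<open>C + U' t0\<close>, which exceeds \<open>C\<close>.\<close>
    define t where "t = t0 + C / U' t0 + 1"
    have "0 < C"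
      using U_pos[OF t0] bound[OF t0] by simp
    then have t: "t0 \<le> t"
      using U'_pos[OF t0] by (simp add: t_def)
    obtain t1 where "t1 \<in> T" "t < t1"
      using False by (auto simp: bdd_above_def not_le)
    then have "t \<in> T"
      using T_between[OF t0, of t1 t] t by simp
    have "(t - t0) * U' t0
        = (\<integral>x. (t - t0) * ((X x * indicator {x. 0 < X x} x) * exp (t0 * X x)) \<partial>N)"
      by (simp add: U'_def)
    also have "\<dots> \<le> U t"
      unfolding U_def
    proof (intro integral_mono integrable_mult_right U_has_derivative(1) U_integrable t0 \<open>t \<in> T\<close>)
      fix x
      have eq: "t * X x = (t - t0) * X x + t0 * X x"
        by (simp add: left_diff_distrib)
      have "(t - t0) * X x \<le> exp ((t - t0) * X x)"
        using exp_ge_add_one_self[of "(t - t0) * X x"] by linarith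
      then have "(t - t0) * X x * exp (t0 * X x) \<le> exp (t * X x)"
        unfolding eq exp_add by (rule mult_right_mono) simp
      then show "(t - t0) * ((X x * indicator {x. 0 < X x} x) * exp (t0 * X x))
          \<le> indicator {x. 0 < X x} x * exp (t * X x)"
        by (cases "0 < X x") (simp_all add: mult.assoc)
    qed
    finally have "(t - t0) * U' t0 \<le> U t" .
    moreover have "(t - t0) * U' t0 = C + U' t0"
      using U'_pos[OF t0] by (simp add: t_def distrib_right)
    ultimately have "C + U' t0 \<le> U t" by simp
    with bound[OF \<open>t \<in> T\<close> t] U'_pos[OF t0] show False by simp
  qed
qed

lemma H_near_1:
  assumes "c < 1"
  shows "\<exists>t\<in>T. c < H t"
proof (cases "c > 0")
  case True
  obtain t0 where t0: "t0 \<in> T" using T_nonempty by blast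
  obtain t where t: "t \<in> T" "t0 \<le> t" "c * L t0 / (1 - c) < U t"
    using U_unbounded_above[OF t0] by blast
  have "c * L t \<le> c * L t0"
    using True L_antimono[OF t0 t(1,2)] by simp
  also have "\<dots> < (1 - c) * U t"
    using t(3) assms by (simp add: field_simps)
  finally have "c < H t"
    using L_pos[OF t(1)] U_pos[OF t(1)] by (simp add: H_def field_simps)
  with t show ?thesis by blast
next
  case False
  obtain t where "t \<in> T" using T_nonempty by blast
  then show ?thesis using False H_bounds(1)[of t] by force
qed

lemma L_unbounded_below:
  assumes t0: "t0 \<in> T" and "bdd_below T"
  shows "\<exists>t\<in>T. t \<le> t0 \<and> C < L t"
proof (rule ccontr)
  assume "\<not> ?thesis"
  then have bound: "L t \<le> C" if "t \<in> T" "t \<le> t0" for t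
    using that by force
  have "Inf T \<in> closure T"
    using assms T_nonempty by (intro closure_contains_Inf)
  then obtain u where u: "\<And>n::nat. u n \<in> T" "u \<longlonglongrightarrow> Inf T"
    unfolding closure_sequential by blast
  \<comment> \<open>Truncation keeps the sequence in the range where \<open>U\<close> is at most \<open>U t0\<close>.\<close>
  define v where "v n = min (u n) t0" for n
  have v: "v n \<in> T" "v n \<le> t0" for n
    using u(1) t0 by (auto simp: v_def min_def)
  have "v \<longlonglongrightarrow> min (Inf T) t0"
    unfolding v_def[abs_def] by (intro tendsto_min u tendsto_const)
  then have lim: "v \<longlonglongrightarrow> Inf T"
    using cInf_lower[OF t0 \<open>bdd_below T\<close>] by (simp add: min_absorb1)
  have "Inf T \<in> T"
    by (rule in_T_if_bounded_at_limit[OF lim v(1), of "max C (U t0)"])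
      (use bound[OF v] U_mono[OF v(1) t0 v(2)] in \<open>auto simp: le_max_iff_disj\<close>)
  then obtain e where e: "e > 0" "cball (Inf T) e \<subseteq> T"
    using T_open open_contains_cball by blast
  then have "Inf T - e \<in> T"
    by (auto simp: subset_iff dist_real_def)
  from cInf_lower[OF this \<open>bdd_below T\<close>] e show False by simp
qed

text \<open>
  The two ends are not mirror images. If \<open>T\<close> extends to minus infinity, \<open>L\<close> may stay bounded,
  because the mass of \<open>X \<le> 0\<close> may all sit at \<open>X = 0\<close>; but \<open>U\<close> tends to \<open>0\<close> by dominated convergence,
  since \<open>X\<close> is strictly positive on its domain of integration.
\<close>

lemma H_near_0:
  assumes "0 < c"
  shows "\<exists>t\<in>T. H t < c"
proof -
  obtain t0 where t0: "t0 \<in> T" using T_nonempty by blast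
  have "\<exists>t\<in>T. U t < c * L t"
  proof (cases "bdd_below T")
    case True
    then obtain t where t: "t \<in> T" "t \<le> t0" "U t0 / c < L t"
      using L_unbounded_below[OF t0] by blast
    have "U t \<le> U t0"
      using U_mono t t0 by blast
    also have "\<dots> < c * L t"
      using t(3) assms by (simp add: field_simps)
    finally show ?thesis using t by blast
  next
    case False
    have in_T: "t0 - real n \<in> T" for n
    proof -
      obtain t1 where "t1 \<in> T" "t1 < t0 - real n"
        using False by (auto simp: bdd_below_def not_le)
      then show ?thesis using T_between[OF _ t0, of t1] by simp
    qed
    have "(\<lambda>n. U (t0 - real n)) \<longlonglongrightarrow> (\<integral>x. 0 \<partial>N)"
      unfolding U_def
    proof (rule integral_dominated_convergence)
      show "integrable N (\<lambda>x. indicator {x. 0 < X x} x * exp (t0 * X x))"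
        by (rule U_integrable[OF t0])
      show "AE x in N. norm (indicator {x. 0 < X x} x * exp ((t0 - real n) * X x))
          \<le> indicator {x. 0 < X x} x * exp (t0 * X x)" for n
        by (auto intro!: AE_I2 split: split_indicator intro: mult_right_mono)
      show "AE x in N. (\<lambda>n. indicator {x. 0 < X x} x * exp ((t0 - real n) * X x)) \<longlonglongrightarrow> 0"
      proof (rule AE_I2)
        fix x
        show "(\<lambda>n. indicator {x. 0 < X x} x * exp ((t0 - real n) * X x)) \<longlonglongrightarrow> 0"
        proof (cases "0 < X x")
          case True
          have "(\<lambda>n. exp (t0 * X x) * exp (- X x) ^ n) \<longlonglongrightarrow> exp (t0 * X x) * 0"
            using True by (intro tendsto_mult_left LIMSEQ_power_zero) simp
          then show ?thesis
            using True by (simp add: exp_of_nat_mult[symmetric] exp_add[symmetric] algebra_simps)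
        qed simp
      qed
    qed auto
    then have "(\<lambda>n. U (t0 - real n)) \<longlonglongrightarrow> 0" by simp
    then have "eventually (\<lambda>n. U (t0 - real n) < c * L t0) sequentially"
      using L_pos[OF t0] assms by (intro order_tendstoD) auto
    then obtain n where n: "U (t0 - real n) < c * L t0"
      by (auto simp: eventually_sequentially)
    also have "\<dots> \<le> c * L (t0 - real n)"
      using L_antimono[OF in_T t0, of n] assms by simp
    finally show ?thesis using in_T by blast
  qed
  then obtain t where t: "t \<in> T" "U t < c * L t" by blast
  moreover have "0 < c * U t" using U_pos[OF t(1)] assms by simp
  ultimately have "H t < c"
    using L_pos[OF t(1)] U_pos[OF t(1)] by (simp add: H_def field_simps)
  with t show ?thesis by blast
qed

definition left_end :: ereal where "left_end = (INF t\<in>T. ereal t)"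
definition right_end :: ereal where "right_end = (SUP t\<in>T. ereal t)"

lemma T_eq: "T = einterval left_end right_end"
  unfolding left_end_def right_end_def by (rule T_eq_einterval)

lemma endpoints_less: "left_end < ereal t" "ereal t < right_end" if "t \<in> T"
  using that T_eq by (auto simp: einterval_iff)

lemma in_T_iff: "t \<in> T \<longleftrightarrow> left_end < ereal t \<and> ereal t < right_end"
  by (subst T_eq) (simp add: einterval_iff)

lemma T_down: "r \<in> T" if "left_end < ereal r" "r < t" "t \<in> T"
  using that by (auto simp: in_T_iff intro: less_trans[of "ereal r" "ereal t"])

lemma T_up: "r \<in> T" if "ereal r < right_end" "t < r" "t \<in> T"
  using that by (auto simp: in_T_iff intro: less_trans[of _ "ereal t" "ereal r"])

text \<open>
  By monotonicity of \<open>H\<close>, a single parameter with a value near the bound gives the limit at the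
  corresponding end of \<open>T\<close>, which may be infinite.
\<close>

lemma H_tendsto_lower: "((H \<circ> real_of_ereal) \<longlongrightarrow> 0) (at_right left_end)"
proof -
  obtain t0 where t0: "t0 \<in> T" using T_nonempty by blast
  have ev: "eventually (\<lambda>y. \<exists>r. y = ereal r \<and> r \<in> T \<and> r < t) (at_right left_end)" if "t \<in> T" for t
  proof (subst eventually_at_right[OF endpoints_less(1)[OF that]], intro exI[of _ "ereal t"] conjI allI impI)
    fix y assume "left_end < y" "y < ereal t"
    moreover from this obtain r where "y = ereal r" by (cases y) auto
    ultimately show "\<exists>r. y = ereal r \<and> r \<in> T \<and> r < t"
      using that by (auto intro: T_down)
  qed (rule endpoints_less(1)[OF that])
  show ?thesis
  proof (rule order_tendstoI)
    fix c :: real assume "c < 0"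
    from ev[OF t0] show "eventually (\<lambda>y. c < (H \<circ> real_of_ereal) y) (at_right left_end)"
      by eventually_elim (use \<open>c < 0\<close> H_bounds(1) in \<open>force intro: less_trans\<close>)
  next
    fix c :: real assume "0 < c"
    then obtain t where t: "t \<in> T" "H t < c" using H_near_0 by blast
    from ev[OF t(1)] show "eventually (\<lambda>y. (H \<circ> real_of_ereal) y < c) (at_right left_end)"
      by eventually_elim (use t(2) in \<open>auto dest!: H_mono[OF _ t(1)]\<close>)
  qed
qed

lemma H_tendsto_upper: "((H \<circ> real_of_ereal) \<longlongrightarrow> 1) (at_left right_end)"
proof -
  obtain t0 where t0: "t0 \<in> T" using T_nonempty by blast
  have ev: "eventually (\<lambda>y. \<exists>r. y = ereal r \<and> r \<in> T \<and> t < r) (at_left right_end)" if "t \<in> T" for t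
  proof (subst eventually_at_left[OF endpoints_less(2)[OF that]], intro exI[of _ "ereal t"] conjI allI impI)
    fix y assume "ereal t < y" "y < right_end"
    moreover from this obtain r where "y = ereal r" by (cases y) auto
    ultimately show "\<exists>r. y = ereal r \<and> r \<in> T \<and> t < r"
      using that by (auto intro: T_up)
  qed (rule endpoints_less(2)[OF that])
  show ?thesis
  proof (rule order_tendstoI)
    fix c :: real assume "1 < c"
    from ev[OF t0] show "eventually (\<lambda>y. (H \<circ> real_of_ereal) y < c) (at_left right_end)"
      by eventually_elim (use \<open>1 < c\<close> H_bounds(2) in \<open>force intro: less_trans\<close>)
  next
    fix c :: real assume "c < 1"
    then obtain t where t: "t \<in> T" "c < H t" using H_near_1 by blast
    from ev[OF t(1)] show "eventually (\<lambda>y. c < (H \<circ> real_of_ereal) y) (at_left right_end)"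
      by eventually_elim (use t(2) in \<open>auto dest!: H_mono[OF t(1)]\<close>)
  qed
qed

lemma nn_integral_H': "(\<integral>\<^sup>+t. ennreal (H' t) * indicator T t \<partial>lborel) = 1"
proof -
  obtain t0 where "t0 \<in> T" using T_nonempty by blast
  from endpoints_less[OF this] have "left_end < right_end" by (rule less_trans)
  from nn_integral_einterval_derivative[OF this _ _ _ H_tendsto_lower H_tendsto_upper, of H']
  show ?thesis
    by (simp add: T_eq[symmetric] H_has_derivative isCont_H' H'_nonneg)
qed

lemma nn_integral_H'_atMost:
  "(\<integral>\<^sup>+u. (ennreal (H' u) * indicator T u) * indicator {..t} u \<partial>lborel)
     = ennreal (if t \<in> T then H t else if ereal t \<le> left_end then 0 else 1)"
proof (cases "t \<in> T")
  case True
  have sub: "einterval left_end t \<subseteq> T"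
    using True by (auto simp: einterval_iff intro: T_down)
  have "(H \<longlongrightarrow> H t) (at_left t)"
    using DERIV_isCont[OF H_has_derivative[OF True]]
    by (simp add: isCont_def filterlim_at_split)
  then have lim: "((H \<circ> real_of_ereal) \<longlongrightarrow> H t) (at_left (ereal t))"
    by (simp add: at_left_ereal filterlim_filtermap)
  have "(\<integral>\<^sup>+u. (ennreal (H' u) * indicator T u) * indicator {..t} u \<partial>lborel)
      = (\<integral>\<^sup>+u. ennreal (H' u) * indicator (einterval left_end t) u \<partial>lborel)"
    \<comment> \<open>The two domains of integration differ only in the point \<open>t\<close>.\<close>
    using AE_lborel_singleton[of t]
  proof (intro nn_integral_cong_AE, eventually_elim)
    fix u assume "u \<noteq> t"
    moreover have "u \<in> T" if "left_end < ereal u" "u < t"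
      using T_down[OF that True] by simp
    moreover have "left_end < ereal u" if "u \<in> T"
      using endpoints_less(1)[OF that] .
    ultimately show "(ennreal (H' u) * indicator T u) * indicator {..t} u
        = ennreal (H' u) * indicator (einterval left_end t) u"
      by (auto split: split_indicator simp: einterval_iff)
  qed
  also have "\<dots> = ennreal (H t - 0)"
    by (rule nn_integral_einterval_derivative[OF endpoints_less(1)[OF True] _ _ _ H_tendsto_lower lim])
      (use sub in \<open>auto intro: H_has_derivative isCont_H' H'_nonneg\<close>)
  finally show ?thesis using True by simp
next
  case outside: False
  show ?thesis
  proof (cases "ereal t \<le> left_end")
    case True
    have "t < u" if "u \<in> T" for u
      using le_less_trans[OF True endpoints_less(1)[OF that]] by simp
    then have "indicator T u * indicator {..t} u = (0::ennreal)" for u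
      by (force split: split_indicator)
    then show ?thesis
      using outside True by (simp only: mult.assoc) simp
  next
    case False
    then have "right_end \<le> ereal t" using outside by (auto simp: in_T_iff)
    then have "u < t" if "u \<in> T" for u
      using less_le_trans[OF endpoints_less(2)[OF that], of "ereal t"] by simp
    then have "indicator T u * indicator {..t} u = (indicator T u :: ennreal)" for u
      by (force split: split_indicator)
    then show ?thesis
      using outside False nn_integral_H' by (simp add: mult.assoc)
  qed
qed

lemma H'_indicator_measurable: "(\<lambda>t. H' t * indicator T t) \<in> borel_measurable borel"
proof -
  have "set_borel_measurable borel T H'"
    using T_open isCont_H' unfolding set_borel_measurable_def
    by (intro borel_measurable_continuous_on_indicator continuous_at_imp_continuous_on) auto
  then show ?thesis by (simp add: set_borel_measurable_def mult.commute)
qed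

end

section \<open>The fiducial distribution of one real parameter\<close>

text \<open>
  This is what the condition \<open>s \<in> S_star \<mu>\<close> is for. A support point above \<open>s\<close> charges the upper part;
  the lower part is charged by a support point below \<open>s\<close> or, if \<open>s\<close> is itself the lower endpoint, by
  the atom there.
\<close>

lemma S_star_nonnull_parts:
  assumes sets: "sets \<mu> = sets borel" and s: "s \<in> S_star \<mu>"
  shows "\<not> (AE y in \<mu>. 0 < y - s)" and "\<not> (AE y in \<mu>. y - s \<le> 0)"
proof -
  have upper: "ereal s < supp_sup \<mu>" and lower: "supp_inf \<mu> \<le> ereal s"
    and atom: "supp_inf \<mu> = ereal s \<Longrightarrow> emeasure \<mu> {y. ereal y = supp_inf \<mu>} > 0"
    using s by (auto simp: S_star_def split: if_splits)
  show "\<not> (AE y in \<mu>. 0 < y - s)"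
  proof
    assume ae: "AE y in \<mu>. 0 < y - s"
    have null: "emeasure \<mu> A = 0" if "A \<in> sets borel" "A \<subseteq> {..s}" for A
    proof -
      have "AE y in \<mu>. y \<notin> A"
        using ae by eventually_elim (use that in auto)
      then show ?thesis
        using that(1) sets AE_iff_null_sets[of A \<mu>] by auto
    qed
    show False
    proof (cases "supp_inf \<mu> = ereal s")
      case True
      then show False using atom null[of "{s}"] by simp
    next
      case False
      with lower have "supp_inf \<mu> < ereal s" by simp
      then obtain x where "x \<in> supp \<mu>" "x < s"
        by (auto simp: supp_inf_def INF_less_iff)
      then have "emeasure \<mu> {..<s} > 0"
        by (auto simp: supp_def)
      moreover have "{..<s} \<subseteq> {..s}" by auto
      ultimately show False using null[of "{..<s}"] by simp
    qed
  qed
  show "\<not> (AE y in \<mu>. y - s \<le> 0)"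
  proof
    assume ae: "AE y in \<mu>. y - s \<le> 0"
    obtain x where "x \<in> supp \<mu>" "s < x"
      using upper unfolding supp_sup_def less_SUP_iff by auto
    then have "emeasure \<mu> {s<..} > 0"
      by (auto simp: supp_def)
    moreover have "emeasure \<mu> {s<..} = 0"
    proof -
      have "AE y in \<mu>. y \<notin> {s<..}"
        using ae by eventually_elim auto
      then show ?thesis
        using sets AE_iff_null_sets[of "{s<..}" \<mu>] by auto
    qed
    ultimately show False by simp
  qed
qed

lemma real_nat_space_shift:
  assumes sets: "sets \<mu> = sets borel"
  shows "real_nat_space \<mu> = {t. integrable \<mu> (\<lambda>y. exp (t * (y - s)))}"
proof -
  note [measurable_cong] = sets
  have "(\<integral>\<^sup>+y. ennreal (exp (t * y)) \<partial>\<mu>) < \<infinity> \<longleftrightarrow> integrable \<mu> (\<lambda>y. exp (t * (y - s)))" for t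
  proof -
    have "(\<integral>\<^sup>+y. ennreal (exp (t * y)) \<partial>\<mu>) < \<infinity> \<longleftrightarrow> integrable \<mu> (\<lambda>y. exp (t * y))"
      by (simp add: integrable_iff_bounded)
    also have "\<dots> \<longleftrightarrow> integrable \<mu> (\<lambda>y. exp (- (t * s)) * exp (t * y))"
      by simp
    also have "(\<lambda>y. exp (- (t * s)) * exp (t * y)) = (\<lambda>y. exp (t * (y - s)))"
      by (simp add: exp_add[symmetric] right_diff_distrib)
    finally show ?thesis .
  qed
  then show ?thesis
    by (simp only: real_nat_space_def)
qed

text \<open>
  The fiducial distribution of a real exponential family. Since the law is normalized, the factor
  \<open>exp (t * s - m t)\<close> that relates its tails to the centred integrals of \<open>exponential_split\<close> is the
  reciprocal of their sum, and it cancels from the upper tail probability.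
\<close>

lemma real_nef_fiducial:
  fixes \<mu> :: "real measure" and m F :: "real \<Rightarrow> real" and s :: real
  assumes sets: "sets \<mu> = sets borel"
    and T_def: "T = real_nat_space \<mu>"
    and T: "open T" "T \<noteq> {}"
    and F_def: "\<And>t. F t = cdf (density \<mu> (\<lambda>y. ennreal (exp (t * y - m t)))) s"
    and prob: "\<And>t. t \<in> T \<Longrightarrow> prob_space (density \<mu> (\<lambda>y. ennreal (exp (t * y - m t))))"
    and s: "s \<in> S_star \<mu>"
  obtains h where "h \<in> borel_measurable borel" "\<And>t. 0 \<le> h t" "\<And>t. t \<notin> T \<Longrightarrow> h t = 0"
    and "\<And>t. t \<in> T \<Longrightarrow> (F has_real_derivative - h t) (at t)"
    and "(\<integral>\<^sup>+t. ennreal (h t) \<partial>lborel) = 1"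
    and "\<And>t. (\<integral>\<^sup>+u. ennreal (h u) * indicator {..t} u \<partial>lborel)
           = ennreal (if t \<in> T then 1 - F t else if ereal t \<le> (INF u\<in>T. ereal u) then 0 else 1)"
    and "\<And>t. t \<in> T \<Longrightarrow> 0 \<le> 1 - F t"
proof -
  note [measurable_cong] = sets
  interpret split: exponential_split \<mu> "\<lambda>y. y - s" T
    using T S_star_nonnull_parts[OF sets s] real_nat_space_shift[OF sets]
    by unfold_locales (auto simp: T_def)
  have sp: "space \<mu> = UNIV"
    using sets_eq_imp_space_eq[OF sets] by simp
  have F: "1 - F t = split.H t" if t: "t \<in> T" for t
  proof -
    let ?P = "density \<mu> (\<lambda>y. ennreal (exp (t * y - m t)))" and ?c = "exp (t * s - m t)"
    interpret prob_space ?P by (rule prob[OF t])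
    have part: "measure ?P {y. P (y - s)} = ?c * (\<integral>y. indicator {y. P (y - s)} y * exp (t * (y - s)) \<partial>\<mu>)"
      if [measurable]: "Measurable.pred borel P" for P
    proof -
      have P: "{y. P (y - s)} \<in> sets borel" by measurable
      have int: "integrable \<mu> (\<lambda>y. ?c * (indicator {y. P (y - s)} y * exp (t * (y - s))))"
        by (intro integrable_mult_right split.integrable_indicator_exp[OF t that])
      have "emeasure ?P {y. P (y - s)}
          = (\<integral>\<^sup>+y. ennreal (?c * (indicator {y. P (y - s)} y * exp (t * (y - s)))) \<partial>\<mu>)"
        using P sets by (subst emeasure_density)
          (auto intro!: nn_integral_cong split: split_indicator simp: exp_add[symmetric] algebra_simps)
      also have "\<dots> = ennreal (\<integral>y. ?c * (indicator {y. P (y - s)} y * exp (t * (y - s))) \<partial>\<mu>)"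
        by (intro nn_integral_eq_integral int) auto
      finally show ?thesis
        by (simp add: measure_def integral_nonneg_AE)
    qed
    have "F t = measure ?P {y. y - s \<le> 0}"
      by (simp add: F_def cdf_def atMost_def)
    then have "F t = ?c * split.L t"
      using part[of "\<lambda>y. y \<le> 0"] by (simp add: split.L_def)
    moreover have "1 - F t = measure ?P (space ?P - {..s})"
      using sets by (subst prob_compl) (auto simp: F_def cdf_def)
    moreover have "space ?P - {..s} = {y. 0 < y - s}"
      using sp by auto
    ultimately have "1 - F t = ?c * split.U t" "?c * (split.L t + split.U t) = 1"
      using part[of "\<lambda>y. 0 < y"] by (simp_all add: split.U_def distrib_left)
    moreover have "?c = 1 / (split.L t + split.U t)"
      using calculation(2) split.L_pos[OF t] split.U_pos[OF t] by (subst eq_divide_eq) auto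
    ultimately show ?thesis
      by (simp add: split.H_def)
  qed
  define h where "h t = split.H' t * indicator T t" for t
  have h_eq: "ennreal (h t) = ennreal (split.H' t) * indicator T t" for t
    by (auto simp: h_def split: split_indicator)
  show ?thesis
  proof (rule that[of h])
    show "h \<in> borel_measurable borel"
      unfolding h_def[abs_def] by (rule split.H'_indicator_measurable)
    show "0 \<le> h t" for t
      using split.H'_nonneg[of t] by (auto simp: h_def split: split_indicator)
    show "h t = 0" if "t \<notin> T" for t
      using that by (simp add: h_def)
    show "(F has_real_derivative - h t) (at t)" if t: "t \<in> T" for t
    proof -
      have "((\<lambda>u. 1 - split.H u) has_real_derivative - h t) (at t)"
        using t by (auto intro!: derivative_eq_intros split.H_has_derivative simp: h_def)
      then show ?thesis
        by (rule has_field_derivative_transform_within_open[OF _ T(1) t]) (simp add: F[symmetric])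
    qed
    show "(\<integral>\<^sup>+t. ennreal (h t) \<partial>lborel) = 1"
      unfolding h_eq by (rule split.nn_integral_H')
    show "(\<integral>\<^sup>+u. ennreal (h u) * indicator {..t} u \<partial>lborel)
        = ennreal (if t \<in> T then 1 - F t else if ereal t \<le> (INF u\<in>T. ereal u) then 0 else 1)" for t
      unfolding h_eq split.nn_integral_H'_atMost by (simp add: F split.left_end_def)
    show "0 \<le> 1 - F t" if "t \<in> T" for t
      using F[OF that] split.H_bounds(1)[OF that] by simp
  qed
qed

section \<open>The joint fiducial distribution\<close>

text \<open>
  Both the product density and the indicator of a lower orthant factor over the coordinates, so
  the measure of the orthant is the product of the one-dimensional values by Tonelli's theorem.
\<close>

lemma is_df_with_density_prod:
  assumes meas: "\<And>k. k < d \<Longrightarrow> h k \<in> borel_measurable borel"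
    and nonneg: "\<And>k t. k < d \<Longrightarrow> 0 \<le> h k t"
    and total: "\<And>k. k < d \<Longrightarrow> (\<integral>\<^sup>+t. ennreal (h k t) \<partial>lborel) = 1"
    and G: "\<And>k t. k < d \<Longrightarrow> (\<integral>\<^sup>+u. ennreal (h k u) * indicator {..t} u \<partial>lborel) = ennreal (G k t)"
    and G_nonneg: "\<And>k t. k < d \<Longrightarrow> 0 \<le> G k t"
  shows "is_df_with_density d (\<lambda>\<phi>. \<Prod>k<d. G k (\<phi> k)) (\<lambda>\<psi>. \<Prod>k<d. h k (\<psi> k))"
proof -
  interpret lborel: product_sigma_finite "\<lambda>_::nat. lborel :: real measure" ..
  let ?h = "\<lambda>\<psi>. \<Prod>k<d. h k (\<psi> k)"
  have h_meas: "?h \<in> borel_measurable (lebR d)"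
  proof (rule borel_measurable_prod)
    fix k assume k: "k \<in> {..<d}"
    have "h k \<in> borel_measurable lborel" using meas k by simp
    from measurable_compose[OF measurable_component_singleton[OF k] this]
    show "(\<lambda>\<psi>. h k (\<psi> k)) \<in> borel_measurable (lebR d)" .
  qed
  have h_ennreal: "ennreal (?h \<psi>) = (\<Prod>k<d. ennreal (h k (\<psi> k)))" for \<psi>
    using nonneg by (subst prod_ennreal) auto
  have "emeasure (density (lebR d) (\<lambda>\<psi>. ennreal (?h \<psi>))) (space (lebR d))
      = (\<integral>\<^sup>+\<psi>. (\<Prod>k<d. ennreal (h k (\<psi> k))) \<partial>lebR d)"
    using h_meas by (subst emeasure_density) (auto simp: h_ennreal[symmetric] intro!: nn_integral_cong)
  also have "\<dots> = (\<Prod>k<d. \<integral>\<^sup>+t. ennreal (h k t) \<partial>lborel)"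
    using meas by (intro lborel.product_nn_integral_prod) auto
  also have "\<dots> = 1" using total by simp
  finally have prob: "prob_space (density (lebR d) (\<lambda>\<psi>. ennreal (?h \<psi>)))"
    by (intro prob_spaceI) simp
  have box: "(\<Prod>k<d. G k (\<phi> k)) = measure (density (lebR d) (\<lambda>\<psi>. ennreal (?h \<psi>)))
      {\<psi> \<in> space (lebR d). \<forall>k<d. \<psi> k \<le> \<phi> k}" for \<phi>
  proof -
    let ?B = "{\<psi> \<in> space (lebR d). \<forall>k<d. \<psi> k \<le> \<phi> k}"
    have "?B = (\<Pi>\<^sub>E k\<in>{..<d}. {..\<phi> k})"
      by (auto simp: space_PiM PiE_def Pi_def)
    then have B: "?B \<in> sets (lebR d)"
      by (simp add: sets_PiM_I_finite)
    have ind: "indicator ?B \<psi> = (\<Prod>k<d. indicator {..\<phi> k} (\<psi> k) :: ennreal)" if "\<psi> \<in> space (lebR d)" for \<psi>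
      using that by (auto split: split_indicator simp: prod_eq_1_iff)
    have "emeasure (density (lebR d) (\<lambda>\<psi>. ennreal (?h \<psi>))) ?B
        = (\<integral>\<^sup>+\<psi>. ennreal (?h \<psi>) * indicator ?B \<psi> \<partial>lebR d)"
      using h_meas B by (subst emeasure_density) auto
    also have "\<dots> = (\<integral>\<^sup>+\<psi>. (\<Prod>k<d. ennreal (h k (\<psi> k)) * indicator {..\<phi> k} (\<psi> k)) \<partial>lebR d)"
      by (intro nn_integral_cong) (simp only: ind h_ennreal prod.distrib)
    also have "\<dots> = (\<Prod>k<d. \<integral>\<^sup>+u. ennreal (h k u) * indicator {..\<phi> k} u \<partial>lborel)"
      using meas by (intro lborel.product_nn_integral_prod) auto
    also have "\<dots> = (\<Prod>k<d. ennreal (G k (\<phi> k)))"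
      using G by simp
    also have "\<dots> = ennreal (\<Prod>k<d. G k (\<phi> k))"
      using G_nonneg by (intro prod_ennreal) auto
    finally show ?thesis
      using prod_nonneg[of "{..<d}" "\<lambda>k. G k (\<phi> k)"] G_nonneg by (simp add: measure_def)
  qed
  show ?thesis
    unfolding is_df_with_density_def using h_meas nonneg prob box by (auto intro: prod_nonneg)
qed

text \<open>
  The image of the reparametrization is a full product set. Any \<open>t \<in> \<Phi> k\<close> is therefore the \<open>k\<close>-th
  coordinate of the new parameter of some member of the family, whose conditional laws are
  probability measures at every point of \<open>D k\<close>.
\<close>

lemma (in cr_nef) prob_space_cond_law:
  assumes k: "k < d" and x: "x \<in> D k" "x \<in> space (euclR k)" and t: "t \<in> \<Phi> k"
  shows "prob_space (cond_law \<nu>c Mc k t x)"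
proof -
  obtain \<theta>0 where "\<theta>0 \<in> \<Theta>" using \<Theta>_nonempty by blast
  then have "g \<theta>0 \<in> PiE {..<d} \<Phi>"
    using reparam by (auto simp: bij_betw_def)
  then have "(g \<theta>0)(k := t) \<in> PiE {..<d} \<Phi>"
    using k t by (auto simp: PiE_def extensional_def)
  then obtain \<theta> where \<theta>: "\<theta> \<in> \<Theta>" "g \<theta> = (g \<theta>0)(k := t)"
    using reparam unfolding bij_betw_def by (metis imageE)
  have "cond_law \<nu>c Mc k (g \<theta> k) \<in> measurable (restrict_space (euclR k) (D k)) (prob_algebra borel)"
    using conditional[OF \<theta>(1) k] by (simp add: is_cond_law_def)
  from measurable_space[OF this, of x] x \<theta>(2) show ?thesis
    by (simp add: space_restrict_space space_prob_algebra)
qed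

lemma (in cr_nef) \<Phi>_nonempty: "\<Phi> k \<noteq> {}" if "k < d"
proof -
  have "PiE {..<d} \<Phi> \<noteq> {}"
    using reparam \<Theta>_nonempty by (auto simp: bij_betw_def)
  then show ?thesis using that by (auto simp: PiE_eq_empty_iff)
qed

theorem proposition6:
  fixes Pr :: "(nat \<Rightarrow> real) \<Rightarrow> 'a measure"
    and S :: "'a \<Rightarrow> nat \<Rightarrow> real"
    and s :: "nat \<Rightarrow> real"
  assumes family: "regular_cr_nef d \<nu> \<Theta> M g \<Phi> D \<nu>c Mc"
    and model: "\<And>\<phi>. \<phi> \<in> PiE {..<d} \<Phi> \<Longrightarrow> prob_space (Pr \<phi>)"
      "\<And>\<phi>. \<phi> \<in> PiE {..<d} \<Phi> \<Longrightarrow> distributed (Pr \<phi>) \<nu> S (\<lambda>x. ennreal (cr_density d Mc \<phi> x))"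
    and s_space: "s \<in> {..<d} \<rightarrow>\<^sub>E UNIV"
    and s_cond: "\<And>k. k < d \<Longrightarrow> restrict s {..<k} \<in> D k"
    and s_natural: "\<And>k. k < d \<Longrightarrow> \<Phi> k = real_nat_space (\<nu>c k (restrict s {..<k}))"
    and s_star: "\<And>k. k < d \<Longrightarrow> s k \<in> S_star (\<nu>c k (restrict s {..<k}))"
  defines "F \<equiv> cond_df \<nu>c Mc s"
  shows "(\<forall>\<phi>\<in>PiE {..<d} \<Phi>. Hjoint d \<Phi> F \<phi> = (\<Prod>k<d. 1 - F k (\<phi> k)))
    \<and> is_fiducial_df d \<Phi> F (Hjoint d \<Phi> F)
    \<and> is_df_with_density d (Hjoint d \<Phi> F) (hjoint d \<Phi> F)
    \<and> (\<forall>k<d. \<forall>t\<in>\<Phi> k. (H1 \<Phi> F k has_real_derivative h1 \<Phi> F k t) (at t)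
                      \<and> (F k has_real_derivative - h1 \<Phi> F k t) (at t))"
proof -
  interpret regular_cr_nef d \<nu> \<Theta> M g \<Phi> D \<nu>c Mc by (rule family)
  have \<Phi>_open: "open (\<Phi> k)" if "k < d" for k
    using cond_open[OF that s_cond[OF that]] s_natural[OF that] by simp
  let ?Q = "\<lambda>k h. h \<in> borel_measurable borel \<and> (\<forall>t. 0 \<le> h t) \<and> (\<forall>t. t \<notin> \<Phi> k \<longrightarrow> h t = 0)
      \<and> (\<forall>t\<in>\<Phi> k. (F k has_real_derivative - h t) (at t))
      \<and> (\<integral>\<^sup>+t. ennreal (h t) \<partial>lborel) = 1
      \<and> (\<forall>t. (\<integral>\<^sup>+u. ennreal (h u) * indicator {..t} u \<partial>lborel) = ennreal (H1 \<Phi> F k t))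
      \<and> (\<forall>t. 0 \<le> H1 \<Phi> F k t)"
  have "\<exists>h. ?Q k h" if k: "k < d" for k
  proof -
    let ?x = "restrict s {..<k}"
    have prob: "prob_space (density (\<nu>c k ?x) (\<lambda>y. ennreal (exp (t * y - Mc k t ?x))))"
      if "t \<in> \<Phi> k" for t
      using prob_space_cond_law[OF k s_cond[OF k] _ that] by (simp add: cond_law_def space_PiM)
    have F_eq: "F k t = cdf (density (\<nu>c k ?x) (\<lambda>y. ennreal (exp (t * y - Mc k t ?x)))) (s k)" for t
      by (simp add: F_def cond_df_def cond_law_def)
    note fid = real_nef_fiducial[OF sets_cond[OF k s_cond[OF k]] s_natural[OF k] \<Phi>_open[OF k]
        \<Phi>_nonempty[OF k] F_eq prob s_star[OF k]]
    obtain h where h: "h \<in> borel_measurable borel" "\<And>t. 0 \<le> h t" "\<And>t. t \<notin> \<Phi> k \<Longrightarrow> h t = 0"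
      "\<And>t. t \<in> \<Phi> k \<Longrightarrow> (F k has_real_derivative - h t) (at t)"
      "(\<integral>\<^sup>+t. ennreal (h t) \<partial>lborel) = 1"
      "\<And>t. (\<integral>\<^sup>+u. ennreal (h u) * indicator {..t} u \<partial>lborel)
           = ennreal (if t \<in> \<Phi> k then 1 - F k t else if ereal t \<le> (INF u\<in>\<Phi> k. ereal u) then 0 else 1)"
      "\<And>t. t \<in> \<Phi> k \<Longrightarrow> 0 \<le> 1 - F k t"
      by (rule fid) (assumption, rule that)
    then have "0 \<le> H1 \<Phi> F k t" for t
      by (simp add: H1_def)
    with h show ?thesis
      by (intro exI[of _ h]) (simp add: H1_def)
  qed
  then have "\<forall>k\<in>{..<d}. \<exists>h. ?Q k h" by blast
  then obtain h where "\<forall>k\<in>{..<d}. ?Q k (h k)" by (rule bchoice[THEN exE])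
  then have Q: "?Q k (h k)" if "k < d" for k using that by simp
  have h: "\<And>k. k < d \<Longrightarrow> h k \<in> borel_measurable borel"
    "\<And>k t. k < d \<Longrightarrow> 0 \<le> h k t" "\<And>k t. k < d \<Longrightarrow> t \<notin> \<Phi> k \<Longrightarrow> h k t = 0"
    and F_deriv: "\<And>k t. k < d \<Longrightarrow> t \<in> \<Phi> k \<Longrightarrow> (F k has_real_derivative - h k t) (at t)"
    and total: "\<And>k. k < d \<Longrightarrow> (\<integral>\<^sup>+t. ennreal (h k t) \<partial>lborel) = 1"
    and df: "\<And>k t. k < d \<Longrightarrow> (\<integral>\<^sup>+u. ennreal (h k u) * indicator {..t} u \<partial>lborel) = ennreal (H1 \<Phi> F k t)"
    and H1_nonneg: "\<And>k t. k < d \<Longrightarrow> 0 \<le> H1 \<Phi> F k t"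
    by (blast dest: Q)+
  have H1_deriv: "(H1 \<Phi> F k has_real_derivative h k t) (at t)" if "k < d" "t \<in> \<Phi> k" for k t
  proof -
    have "((\<lambda>u. 1 - F k u) has_real_derivative h k t) (at t)"
      using F_deriv[OF that] by (auto intro!: derivative_eq_intros)
    then show ?thesis
      by (rule has_field_derivative_transform_within_open[OF _ \<Phi>_open[OF that(1)] that(2)])
        (simp add: H1_def)
  qed
  have h1_eq: "h1 \<Phi> F k = h k" if "k < d" for k
    using h(3)[OF that] DERIV_imp_deriv[OF H1_deriv[OF that]] by (auto simp: h1_def)
  have fid_eq: "fid_density1 \<Phi> F k = h k" if "k < d" for k
    using h(2,3)[OF that] DERIV_imp_deriv[OF F_deriv[OF that]] by (auto simp: fid_density1_def)
  have joint: "is_df_with_density d (Hjoint d \<Phi> F) (\<lambda>\<psi>. \<Prod>k<d. h k (\<psi> k))"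
    unfolding Hjoint_def[abs_def]
    by (rule is_df_with_density_prod[OF h(1,2) total df H1_nonneg])
  have "prob_space (density lborel (\<lambda>t. ennreal (h k t)))" if "k < d" for k
    using h(1)[OF that] total[OF that] by (intro prob_spaceI) (simp add: emeasure_density)
  moreover have "(\<lambda>\<psi>. \<Prod>k<d. fid_density1 \<Phi> F k (\<psi> k)) = (\<lambda>\<psi>. \<Prod>k<d. h k (\<psi> k))"
    by (intro ext prod.cong refl) (simp add: fid_eq)
  moreover have "F k field_differentiable at t" if "k < d" "t \<in> \<Phi> k" for k t
    using F_deriv[OF that] field_differentiable_def by blast
  ultimately have fiducial: "is_fiducial_df d \<Phi> F (Hjoint d \<Phi> F)"
    unfolding is_fiducial_df_def using joint h(1) by (simp add: fid_eq)
  have "hjoint d \<Phi> F = (\<lambda>\<psi>. \<Prod>k<d. h k (\<psi> k))"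
    unfolding hjoint_def[abs_def] by (intro ext prod.cong refl) (simp add: h1_eq)
  with joint have density: "is_df_with_density d (Hjoint d \<Phi> F) (hjoint d \<Phi> F)"
    by simp
  have "Hjoint d \<Phi> F \<phi> = (\<Prod>k<d. 1 - F k (\<phi> k))" if "\<phi> \<in> PiE {..<d} \<Phi>" for \<phi>
    unfolding Hjoint_def H1_def using that by (intro prod.cong) auto
  with fiducial density show ?thesis
    using H1_deriv F_deriv by (auto simp: h1_eq)
qed

end
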